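(* Let $T\ge1$ and $d\ge1$ be integers, $D>0$, $L>0$. For any optimality gap $\epsilon>0$ there exist a multistage problem of the form described in the context (i.e. $L$-Lipschitz continuous functions $f_1,\dots,f_T:\mathcal X\to\mathbb R_+$ with $\epsilon/T<f_t(x)<2\epsilon/T$ for all $x\in\mathcal X$) and subproblem oracles (selections of optimal solutions in the algorithm's subproblems) such that, if the deterministic sampling dual dynamic programming algorithm described in the context gives $\mathrm{UB}-\mathrm{LB}\le\epsilon$ in the $i$-th iteration, then $$i\ge\left(\frac{DLT}{4\epsilon}\right)^d.$$
   Context: **Problem form.** Let $\|\cdot\|$ be a norm on $\mathbb R^d$ and $\mathcal X=\{x\in\mathbb R^d:\|x\|\le D/2\}$; all state spaces equal $\mathcal X$. The scenario tree is a chain (one node per stage $0,1,\dots,T$), and the problem is given by value functions $$Q_r=\min_{x_0\in\mathcal X}Q_1(x_0),\quad Q_t(x_{t-1})=\min_{x_t\in\mathcal X}\{f_t(x_{t-1})+Q_{t+1}(x_t)\}\ (1\le t\le T-1),\quad Q_T(x_{T-1})=f_T(x_{T-1}),$$ where each $f_t:\mathcal X\to\mathbb R_+$ is $L$-Lipschitz and $\epsilon/T<f_t(x)<2\epsilon/T$ on $\mathcal X$. **Algorithm on this problem** (penalty functions $\psi=\|\cdot\|$, penalty parameters $L$, dual bounds $l_\lambda=0$ for linear terms and $l_\rho=L$ for the penalty term). Each "optimal solution" is the one returned by a subproblem oracle. Initialize $\underline Q_t^0\equiv0$, $\overline Q_t^0\equiv+\infty$ for $1\le t\le T$, and $\underline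 Q_{T+1}^i\equiv\overline Q_{T+1}^i\equiv0$ for all $i$; $x_0^1\in\mathcal X$ is an optimal solution of $\min_{x\in\mathcal X}0$; $\mathrm{LB}=0$, $\mathrm{UB}=+\infty$. Iteration $i=1,2,\dots$: (Forward) for $t=1,\dots,T$, $(x_t^i,z_t^i)$ is an optimal solution of $\min_{x,z\in\mathcal X}\{f_t(z)+L\|x_{t-1}^i-z\|+\underline Q_{t+1}^{i-1}(x)\}$. (Backward) for $t=T,\dots,1$, $\underline v_t^i$ is the optimal value and $\hat\rho_t^i$ an optimal outer solution of $\max_{0\le\rho\le L}\min_{x,z\in\mathcal X}\{f_t(z)+\rho\|x_{t-1}^i-z\|+\underline Q_{t+1}^i(x)\}$; $\bar v_t^i=f_t(z_t^i)+L\|x_{t-1}^i-z_t^i\|+\overline Q_{t+1}^i(x_t^i)$; and $$\underline Q_t^i(x)=\max\{\underline Q_t^{i-1}(x),\ \underline v_t^i-\hat\rho_t^i\|x-x_{t-1}^i\|\},\qquad \overline Q_t^i(x)=\min\{\overline Q_t^{i-1}(x),\ \bar v_t^i+L\|x-x_{t-1}^i\|\}.$$ (Root) $x_0^{i+1}$ is an optimal solution of $\min_{x\in\mathcal X}\underline Q_1^i(x)$; set $\mathrm{LB}=\underline Q_1^i(x_0^{i+1})$ and replace $\mathrm{UB}$ by $\min\{\mathrm{UB},\overline Q_1^i(x_0^{i+1})\}$. The values of $\mathrm{UB},\mathrm{LB}$ "in the $i$-th iteration" are those after this update. *)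

theory Defs
  imports "HOL-Analysis.Analysis"
begin

text \<open>The ambient norm is arbitrary and in general differs from the Euclidean norm that the type
  \<open>real ^ 'd\<close> carries, so it is a function with the norm axioms. Topological notions such as
  continuity do not depend on the choice of norm.\<close>

definition is_norm :: "('a::real_vector \<Rightarrow> real) \<Rightarrow> bool" where
  "is_norm N \<longleftrightarrow>
     (\<forall>x. N x \<ge> 0) \<and> (\<forall>x. N x = 0 \<longleftrightarrow> x = 0) \<and>
     (\<forall>a x. N (a *\<^sub>R x) = \<bar>a\<bar> * N x) \<and> (\<forall>x y. N (x + y) \<le> N x + N y)"

definition lipschitz_wrt :: "('a::real_vector \<Rightarrow> real) \<Rightarrow> real \<Rightarrow> 'a set \<Rightarrow> ('a \<Rightarrow> real) \<Rightarrow> bool" where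
  "lipschitz_wrt N L X g \<longleftrightarrow> (\<forall>x\<in>X. \<forall>y\<in>X. \<bar>g x - g y\<bar> \<le> L * N (x - y))"

definition state_space :: "('a \<Rightarrow> real) \<Rightarrow> real \<Rightarrow> 'a set" where
  "state_space N D = {x. N x \<le> D / 2}"

text \<open>The quantities carried from one iteration to the next. After iteration \<open>i\<close>, \<open>under t\<close> and
  \<open>over t\<close> are the lower and upper approximations of the \<open>t\<close>-th value function with superscript
  \<open>i\<close>, and \<open>root\<close> is the root state \<open>x\<^sub>0\<close> with superscript \<open>i + 1\<close>, i.e. the one from which the next
  forward pass starts.\<close>

record 'a ddp_state =
  under :: "nat \<Rightarrow> 'a \<Rightarrow> real"
  over :: "nat \<Rightarrow> 'a \<Rightarrow> ereal"
  root :: 'a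

text \<open>The oracles see a subproblem through its data: the root oracle gets the objective, and the
  forward and backward oracles get the stage, the incoming state and the lower approximation of the
  next value function. Their answers are thus fixed selections of optimal solutions.\<close>

locale ddp =
  fixes N :: "real ^ 'd \<Rightarrow> real"
    and D L :: real
    and T :: nat
    and f :: "nat \<Rightarrow> real ^ 'd \<Rightarrow> real"
    and root_oracle :: "(real ^ 'd \<Rightarrow> real) \<Rightarrow> real ^ 'd"
    and fwd_oracle :: "nat \<Rightarrow> real ^ 'd \<Rightarrow> (real ^ 'd \<Rightarrow> real) \<Rightarrow> (real ^ 'd) \<times> (real ^ 'd)"
    and bwd_oracle :: "nat \<Rightarrow> real ^ 'd \<Rightarrow> (real ^ 'd \<Rightarrow> real) \<Rightarrow> real"
begin

abbreviation X :: "(real ^ 'd) set" where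
  "X \<equiv> state_space N D"

definition penalized_cost ::
  "nat \<Rightarrow> real \<Rightarrow> real ^ 'd \<Rightarrow> (real ^ 'd \<Rightarrow> real) \<Rightarrow> (real ^ 'd) \<times> (real ^ 'd) \<Rightarrow> real" where
  "penalized_cost t \<rho> y Q = (\<lambda>(x, z). f t z + \<rho> * N (y - z) + Q x)"

definition dual_function :: "nat \<Rightarrow> real ^ 'd \<Rightarrow> (real ^ 'd \<Rightarrow> real) \<Rightarrow> real \<Rightarrow> real" where
  "dual_function t y Q \<rho> = (INF p\<in>X \<times> X. penalized_cost t \<rho> y Q p)"

definition dual_value :: "nat \<Rightarrow> real ^ 'd \<Rightarrow> (real ^ 'd \<Rightarrow> real) \<Rightarrow> real" where
  "dual_value t y Q = (SUP \<rho>\<in>{0..L}. dual_function t y Q \<rho>)"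

text \<open>All approximations generated below are continuous, so the oracles are only required to solve
  subproblems with continuous data; those always have optimal solutions, by compactness.\<close>

definition optimal_oracles :: bool where
  "optimal_oracles \<longleftrightarrow>
     (\<forall>Q. continuous_on X Q \<longrightarrow>
        is_arg_min Q (\<lambda>x. x \<in> X) (root_oracle Q) \<and>
        (\<forall>t\<in>{1..T}. \<forall>y\<in>X.
           is_arg_min (penalized_cost t L y Q) (\<lambda>p. p \<in> X \<times> X) (fwd_oracle t y Q) \<and>
           is_arg_max (dual_function t y Q) (\<lambda>\<rho>. \<rho> \<in> {0..L}) (bwd_oracle t y Q)))"

text \<open>\<open>forward Q x0 t\<close> is the pair \<open>(x\<^sub>t, z\<^sub>t)\<close> for \<open>t \<ge> 1\<close>; for \<open>t = 0\<close> only the first component,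
  \<open>x\<^sub>0\<close>, is meaningful.\<close>

primrec forward ::
  "(nat \<Rightarrow> real ^ 'd \<Rightarrow> real) \<Rightarrow> real ^ 'd \<Rightarrow> nat \<Rightarrow> (real ^ 'd) \<times> (real ^ 'd)" where
  "forward Q x0 0 = (x0, x0)"
| "forward Q x0 (Suc t) = fwd_oracle (Suc t) (fst (forward Q x0 t)) (Q (Suc (Suc t)))"

text \<open>Backward passes: the argument \<open>Q\<close> holds the approximations of the previous iteration, the
  pairs \<open>p t\<close> come from the current forward pass, and \<open>t\<close> runs from \<open>T\<close> down to \<open>1\<close>.\<close>

function backward_under ::
  "(nat \<Rightarrow> real ^ 'd \<Rightarrow> real) \<Rightarrow> (nat \<Rightarrow> (real ^ 'd) \<times> (real ^ 'd)) \<Rightarrow> nat \<Rightarrow> real ^ 'd \<Rightarrow> real" where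
  "backward_under Q p t =
     (if t \<le> T then
        (let y = fst (p (t - 1));
             R = backward_under Q p (Suc t);
             v = dual_value t y R;
             \<rho> = bwd_oracle t y R
         in (\<lambda>x. max (Q t x) (v - \<rho> * N (x - y))))
      else (\<lambda>x. 0))"
  by auto
termination by (relation "Wellfounded.measure (\<lambda>(Q, p, t). Suc T - t)") auto

declare backward_under.simps [simp del]

function backward_over ::
  "(nat \<Rightarrow> real ^ 'd \<Rightarrow> ereal) \<Rightarrow> (nat \<Rightarrow> (real ^ 'd) \<times> (real ^ 'd)) \<Rightarrow> nat \<Rightarrow> real ^ 'd \<Rightarrow> ereal" where
  "backward_over Q p t =
     (if t \<le> T then
        (let y = fst (p (t - 1));
             R = backward_over Q p (Suc t);
             v = ereal (f t (snd (p t)) + L * N (y - snd (p t))) + R (fst (p t))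
         in (\<lambda>x. min (Q t x) (v + ereal (L * N (x - y)))))
      else (\<lambda>x. 0))"
  by auto
termination by (relation "Wellfounded.measure (\<lambda>(Q, p, t). Suc T - t)") auto

declare backward_over.simps [simp del]

primrec iterate :: "nat \<Rightarrow> (real ^ 'd) ddp_state" where
  "iterate 0 =
     \<lparr>under = (\<lambda>t x. 0), over = (\<lambda>t x. if t \<le> T then \<infinity> else 0), root = root_oracle (\<lambda>x. 0)\<rparr>"
| "iterate (Suc i) =
     (let s = iterate i;
          p = forward (under s) (root s);
          U = backward_under (under s) p
      in \<lparr>under = U, over = backward_over (over s) p, root = root_oracle (U 1)\<rparr>)"

definition LB :: "nat \<Rightarrow> real" where
  "LB i = (if i = 0 then 0 else under (iterate i) 1 (root (iterate i)))"

primrec UB :: "nat \<Rightarrow> ereal" where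
  "UB 0 = \<infinity>"
| "UB (Suc i) = min (UB i) (over (iterate (Suc i)) 1 (root (iterate (Suc i))))"

end

end

theory Submission imports Defs begin

text \<open>With constant stage costs \<open>c = 3\<epsilon>/(2T)\<close> every dual multiplier is optimal, and the oracle
  answers \<open>L\<close>. As long as the lower approximation of the next stage still vanishes somewhere, the new
  cut has height \<open>c\<close> and slope \<open>L\<close>, so it is positive only on a norm ball of radius \<open>c/L\<close>.
  By comparing volumes, fewer than \<open>(DL/(2c))\<^sup>d\<close> such balls cannot cover the state space; until then
  \<open>LB = 0\<close>, whereas \<open>UB \<ge> Tc > \<epsilon>\<close> always.\<close>

section \<open>Norms on Euclidean space\<close>

context
  fixes N :: "'a::euclidean_space \<Rightarrow> real"
  assumes N: "is_norm N"
begin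

section \<open>Continuity and Euclidean comparison of \<open>N\<close>\<close>

lemma is_norm_nonneg: "N x \<ge> 0"
  and is_norm_eq_0_iff: "N x = 0 \<longleftrightarrow> x = 0"
  and is_norm_scaleR: "N (a *\<^sub>R x) = \<bar>a\<bar> * N x"
  and is_norm_triangle: "N (x + y) \<le> N x + N y"
  using N by (auto simp: is_norm_def)

text \<open>A norm is convex, and convex functions on a finite-dimensional space are
  continuous.\<close>

lemma is_norm_continuous_on: "continuous_on S N"
proof -
  have "convex_on UNIV N"
  proof (rule convex_onI)
    fix t :: real and x y :: 'a
    assume "0 < t" "t < 1"
    then show "N ((1 - t) *\<^sub>R x + t *\<^sub>R y) \<le> (1 - t) * N x + t * N y"
      using is_norm_triangle[of "(1 - t) *\<^sub>R x" "t *\<^sub>R y"] by (simp add: is_norm_scaleR)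
  qed simp
  then have "continuous_on UNIV N"
    by (intro convex_on_continuous) auto
  then show ?thesis
    by (rule continuous_on_subset) simp
qed

text \<open>\<open>N\<close> attains a positive minimum on the compact Euclidean unit sphere, and
  homogeneity carries the bound to all \<open>x\<close>. This makes \<open>N\<close>-balls
  bounded.\<close>

lemma is_norm_lower_bound: "\<exists>m>0. \<forall>x. m * norm x \<le> N x"
proof -
  obtain x0 :: 'a where x0: "x0 \<in> sphere 0 1" "\<forall>x\<in>sphere 0 1. N x0 \<le> N x"
    using continuous_attains_inf[of "sphere 0 1" N] is_norm_continuous_on by auto
  have "x0 \<noteq> 0" using x0(1) by auto
  then have "N x0 > 0"
    using is_norm_nonneg[of x0] is_norm_eq_0_iff[of x0] by linarith
  moreover have "N x0 * norm x \<le> N x" for x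
  proof (cases "x = 0")
    case True
    then show ?thesis using is_norm_nonneg[of x] by simp
  next
    case False
    then have "N x0 \<le> N (inverse (norm x) *\<^sub>R x)"
      using x0(2) by simp
    then show ?thesis
      using False by (simp add: is_norm_scaleR field_simps)
  qed
  ultimately show ?thesis by blast
qed

section \<open>Compactness and volume of norm balls\<close>

lemma compact_norm_ball: "compact {x. N x \<le> r}"
proof -
  obtain m where m: "m > 0" "\<And>x. m * norm x \<le> N x"
    using is_norm_lower_bound by blast
  have "norm x \<le> r / m" if "N x \<le> r" for x
    using m(1) m(2)[of x] that by (simp add: field_simps)
  then have "bounded {x. N x \<le> r}"
    by (auto simp: bounded_iff)
  moreover have "closed {x. N x \<le> r}"
    by (intro closed_Collect_le is_norm_continuous_on continuous_on_const)
  ultimately show ?thesis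
    by (simp add: compact_eq_bounded_closed)
qed

lemma norm_ball_eq_image:
  assumes "r > 0"
  shows "{x. N (x - y) \<le> r} = (\<lambda>x. r *\<^sub>R x + y) ` {x. N x \<le> 1}"
proof (intro set_eqI iffI)
  fix x assume "x \<in> {x. N (x - y) \<le> r}"
  then have "N (inverse r *\<^sub>R (x - y)) \<le> 1"
    using assms unfolding is_norm_scaleR by (simp add: field_simps)
  moreover have "x = r *\<^sub>R (inverse r *\<^sub>R (x - y)) + y"
    using assms by simp
  ultimately show "x \<in> (\<lambda>x. r *\<^sub>R x + y) ` {x. N x \<le> 1}"
    by blast
qed (use assms in \<open>auto simp: is_norm_scaleR\<close>)

lemma norm_ball_lmeasurable:
  assumes "r > 0"
  shows "{x. N (x - y) \<le> r} \<in> lmeasurable"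
  unfolding norm_ball_eq_image[OF assms]
  by (intro lmeasurable_compact compact_continuous_image continuous_intros compact_norm_ball)

lemma measure_norm_ball:
  assumes "r > 0"
  shows "measure lebesgue {x. N (x - y) \<le> r} = r ^ DIM('a) * measure lebesgue {x. N x \<le> 1}"
  using assms unfolding norm_ball_eq_image[OF assms]
  by (simp add: measure_lebesgue_affine)

text \<open>The open unit ball is a nonempty open set. Positivity lets this volume be cancelled in
  the covering bound.\<close>

lemma measure_unit_norm_ball_pos: "measure lebesgue {x. N x \<le> 1} > 0"
proof -
  have "open {x. N x < 1}"
    by (intro open_Collect_less is_norm_continuous_on continuous_on_const)
  moreover have "0 \<in> {x. N x < 1}"
    using is_norm_eq_0_iff[of 0] by simp
  ultimately have "\<not> negligible {x. N x < 1}"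
    using open_not_negligible by blast
  then have "\<not> negligible {x. N x \<le> 1}"
    by (rule contrapos_nn) (auto intro: negligible_subset)
  moreover have "{x. N x \<le> 1} \<in> lmeasurable"
    by (intro lmeasurable_compact compact_norm_ball)
  ultimately show ?thesis
    by (metis negligible_iff_measure zero_less_measure_iff)
qed

text \<open>In units of the unit ball's volume, the covering balls have at most
  \<open>card S * r ^ DIM('a)\<close> together and the covered ball has
  \<open>R ^ DIM('a)\<close>.\<close>

lemma card_norm_ball_cover:
  assumes "finite S" and "r > 0" and "R > 0"
    and cover: "{x. N x \<le> R} \<subseteq> (\<Union>y\<in>S. {x. N (x - y) \<le> r})"
  shows "(R / r) ^ DIM('a) \<le> real (card S)"
proof -
  let ?\<mu> = "measure lebesgue"
  let ?V = "?\<mu> {x. N x \<le> 1}"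
  have "R ^ DIM('a) * ?V = ?\<mu> {x. N (x - 0) \<le> R}"
    using measure_norm_ball[OF \<open>R > 0\<close>] by metis
  also have "\<dots> \<le> ?\<mu> (\<Union>y\<in>S. {x. N (x - y) \<le> r})"
    using assms norm_ball_lmeasurable[OF \<open>R > 0\<close>, of 0] norm_ball_lmeasurable[OF \<open>r > 0\<close>]
    by (intro measure_mono_fmeasurable fmeasurable.finite_UN) auto
  also have "\<dots> \<le> (\<Sum>y\<in>S. ?\<mu> {x. N (x - y) \<le> r})"
    using norm_ball_lmeasurable[OF \<open>r > 0\<close>] \<open>finite S\<close> by (intro measure_UNION_le) auto
  also have "\<dots> = real (card S) * r ^ DIM('a) * ?V"
    by (simp add: measure_norm_ball[OF \<open>r > 0\<close>])
  finally have "R ^ DIM('a) \<le> real (card S) * r ^ DIM('a)"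
    using measure_unit_norm_ball_pos by simp
  then show ?thesis
    using \<open>r > 0\<close> by (simp add: power_divide field_simps)
qed

end

section \<open>The algorithm with constant stage costs\<close>

text \<open>A constant cost ignores \<open>z\<close>, so the forward oracle may copy the incoming
  state, \<open>z = y\<close>, and pay no penalty; \<open>x\<close> then minimises \<open>Q\<close>
  alone. The backward oracle takes the steepest allowed slope, which makes cuts as narrow as
  possible.\<close>

locale constant_cost_ddp =
  ddp N D L T "\<lambda>t x. c" root_oracle "\<lambda>t y Q. (root_oracle Q, y)" "\<lambda>t y Q. L"
  for N :: "real ^ 'd \<Rightarrow> real" and D L :: real and T :: nat and c :: real
    and root_oracle :: "(real ^ 'd \<Rightarrow> real) \<Rightarrow> real ^ 'd" +
  assumes N: "is_norm N" and D_pos: "D > 0" and L_pos: "L > 0" and c_pos: "c > 0"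
    and root_oracle: "continuous_on X Q \<Longrightarrow> is_arg_min Q (\<lambda>x. x \<in> X) (root_oracle Q)"
begin

section \<open>Optimal solutions of the subproblems\<close>

lemma root_oracle_in: "continuous_on X Q \<Longrightarrow> root_oracle Q \<in> X"
  and root_oracle_le: "continuous_on X Q \<Longrightarrow> x \<in> X \<Longrightarrow> Q (root_oracle Q) \<le> Q x"
  using root_oracle[of Q] by (auto simp: is_arg_min_linorder)

lemma N_0: "N 0 = 0"
  using is_norm_eq_0_iff[OF N, of 0] by simp

text \<open>Each of the three cost terms is minimal separately. A general \<rho> is allowed because
  the same pair solves the inner problem of the dual.\<close>

lemma fwd_optimal:
  assumes "continuous_on X Q" and "y \<in> X" and "\<rho> \<ge> 0"
  shows "is_arg_min (penalized_cost t \<rho> y Q) (\<lambda>p. p \<in> X \<times> X) (root_oracle Q, y)"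
  using assms
  by (auto simp: is_arg_min_linorder penalized_cost_def N_0 root_oracle_in is_norm_nonneg[OF N]
      intro!: add_increasing root_oracle_le)

text \<open>The penalty vanishes at the minimiser, so the value is the same for every multiplier;
  this justifies the answer \<open>L\<close>.\<close>

lemma dual_function_eq:
  assumes "continuous_on X Q" and "y \<in> X" and "\<rho> \<ge> 0"
  shows "dual_function t y Q \<rho> = c + Q (root_oracle Q)"
proof -
  have "(INF p\<in>X \<times> X. penalized_cost t \<rho> y Q p) = penalized_cost t \<rho> y Q (root_oracle Q, y)"
    using fwd_optimal[OF assms, of t]
    by (intro cInf_eq_minimum) (auto simp: is_arg_min_linorder)
  then show ?thesis
    by (simp add: dual_function_def penalized_cost_def N_0)
qed

lemma dual_value_eq:
  assumes "continuous_on X Q" and "y \<in> X"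
  shows "dual_value t y Q = c + Q (root_oracle Q)"
proof -
  have "dual_value t y Q = (SUP \<rho>\<in>{0..L}. c + Q (root_oracle Q))"
    unfolding dual_value_def using assms by (intro SUP_cong) (auto simp: dual_function_eq)
  then show ?thesis
    using L_pos by simp
qed

lemma optimal_oracles: optimal_oracles
  unfolding optimal_oracles_def
  using root_oracle fwd_optimal L_pos
  by (auto simp: is_arg_max_linorder dual_function_eq)

section \<open>Feasibility and continuity of the iterates\<close>

lemma forward_in:
  assumes "\<And>t. continuous_on X (Q t)" and "x0 \<in> X"
  shows "fst (forward Q x0 t) \<in> X"
  using assms by (cases t) (auto intro: root_oracle_in)

text \<open>The root oracle is specified only for continuous objectives. A cut is continuous
  whatever its height and slope, so a case split on \<open>t\<close> suffices.\<close>

lemma backward_under_continuous: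
  assumes "\<And>t. continuous_on X (Q t)"
  shows "continuous_on X (backward_under Q p t)"
proof (cases "t \<le> T")
  case True
  then show ?thesis
    using assms
    by (subst backward_under.simps)
      (auto simp: Let_def
        intro!: continuous_intros continuous_on_compose2[OF is_norm_continuous_on[OF N, of UNIV]])
next
  case False
  then show ?thesis by (subst backward_under.simps) simp
qed

lemma under_continuous: "continuous_on X (under (iterate i) t)"
proof (induction i arbitrary: t)
  case (Suc i)
  then show ?case by (simp add: Let_def backward_under_continuous)
qed simp

lemma root_in: "root (iterate i) \<in> X"
  by (cases i) (auto simp: Let_def intro!: root_oracle_in backward_under_continuous under_continuous)

section \<open>Cut centres and the lower bound\<close>

text \<open>\<open>S\<close> stands for the centres of the cuts. A cut of height \<open>c\<close>
  and slope \<open>L\<close> falls to 0 at distance \<open>c / L\<close> from its centre.\<close>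

definition uncovered :: "(real ^ 'd) set \<Rightarrow> (real ^ 'd) set" where
  "uncovered S = {x \<in> X. \<forall>y\<in>S. N (x - y) > c / L}"

lemma uncovered_nonempty:
  assumes "finite S" and "real (card S) < (D * L / (2 * c)) ^ CARD('d)"
  shows "uncovered S \<noteq> {}"
proof
  assume "uncovered S = {}"
  then have "{x. N x \<le> D / 2} \<subseteq> (\<Union>y\<in>S. {x. N (x - y) \<le> c / L})"
    unfolding uncovered_def state_space_def by force
  then have "(D / 2 / (c / L)) ^ DIM(real ^ 'd) \<le> real (card S)"
    using assms(1) D_pos L_pos c_pos by (intro card_norm_ball_cover[OF N]) auto
  then show False
    using assms(2) by simp
qed

text \<open>Downward induction on the stage. By the volume bound the next stage's new approximation
  is still nonpositive somewhere, so its minimum is at most 0 and the new cut has height at most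
  \<open>c\<close>: one more centre is enough.\<close>

lemma backward_under_le_0:
  assumes cont: "\<And>t. continuous_on X (Q t)" and p: "\<And>t. fst (p t) \<in> X"
    and Q: "\<And>t. \<exists>S. finite S \<and> card S \<le> i \<and> (\<forall>x\<in>uncovered S. Q t x \<le> 0)"
    and i: "real (Suc i) < (D * L / (2 * c)) ^ CARD('d)"
  shows "\<exists>S. finite S \<and> card S \<le> Suc i \<and> (\<forall>x\<in>uncovered S. backward_under Q p t x \<le> 0)"
proof (induction "Suc T - t" arbitrary: t)
  case 0
  then have "\<not> t \<le> T" by simp
  then have "backward_under Q p t = (\<lambda>x. 0)"
    by (subst backward_under.simps) simp
  then show ?case by (intro exI[of _ "{}"]) simp
next
  case (Suc n)
  then have "t \<le> T" by simp
  define R where "R = backward_under Q p (Suc t)"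
  define y where "y = fst (p (t - 1))"
  have contR: "continuous_on X R"
    unfolding R_def by (rule backward_under_continuous) (rule cont)
  have "n = Suc T - Suc t"
    using Suc.hyps(2) by simp
  then obtain S where S: "finite S" "card S \<le> Suc i" "\<And>x. x \<in> uncovered S \<Longrightarrow> R x \<le> 0"
    using Suc.hyps(1) unfolding R_def by blast
  \<comment> \<open>\<open>R\<close> may already contain a cut of this iteration, hence the bound at
    \<open>Suc i\<close> instead of \<open>i\<close>.\<close>
  have "uncovered S \<noteq> {}"
    using S i by (intro uncovered_nonempty) auto
  then obtain x where x: "x \<in> X" "R x \<le> 0"
    using S(3) unfolding uncovered_def by blast
  then have root_le: "R (root_oracle R) \<le> 0"
    using root_oracle_le[OF contR] by fastforce
  have step: "backward_under Q p t x = max (Q t x) (c + R (root_oracle R) - L * N (x - y))" for x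
    using \<open>t \<le> T\<close> p[of "t - 1"] contR
    by (subst backward_under.simps) (simp add: Let_def dual_value_eq y_def flip: R_def)
  obtain S' where S': "finite S'" "card S' \<le> i" "\<And>x. x \<in> uncovered S' \<Longrightarrow> Q t x \<le> 0"
    using Q[of t] by blast
  \<comment> \<open>Avoiding \<open>S'\<close> handles the old cuts; avoiding \<open>y\<close> puts
    the new cut at or below 0.\<close>
  have "backward_under Q p t x \<le> 0" if "x \<in> uncovered (insert y S')" for x
  proof -
    have "Q t x \<le> 0" using that by (intro S'(3)) (auto simp: uncovered_def)
    moreover have "c \<le> L * N (x - y)"
      using that L_pos by (auto simp: uncovered_def field_simps)
    ultimately show ?thesis
      unfolding step using root_le by simp
  qed
  moreover have "card (insert y S') \<le> Suc i"
    using S'(1,2) card_insert_le_m1[of "Suc i" S' y] by simp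
  ultimately show ?case
    using S'(1) by (intro exI[of _ "insert y S'"]) simp
qed

lemma under_le_0:
  assumes "real i < (D * L / (2 * c)) ^ CARD('d)"
  shows "\<exists>S. finite S \<and> card S \<le> i \<and> (\<forall>x\<in>uncovered S. under (iterate i) t x \<le> 0)"
  using assms
proof (induction i arbitrary: t)
  case 0
  show ?case by (intro exI[of _ "{}"]) simp
next
  case (Suc i)
  have "real i < (D * L / (2 * c)) ^ CARD('d)"
    using Suc.prems by simp
  then show ?case
    using Suc
    by (simp add: Let_def)
      (intro backward_under_le_0 under_continuous forward_in root_in, auto)
qed

text \<open>For \<open>i > 0\<close>, \<open>LB i\<close> is the minimum over \<open>X\<close> of
  the first-stage approximation, which is at most 0 at an uncovered point.\<close>

lemma LB_le_0:
  assumes "real i < (D * L / (2 * c)) ^ CARD('d)"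
  shows "LB i \<le> 0"
proof (cases i)
  case 0
  then show ?thesis by (simp add: LB_def)
next
  case (Suc j)
  let ?U = "under (iterate i) 1"
  obtain S where S: "finite S" "card S \<le> i" "\<forall>x\<in>uncovered S. ?U x \<le> 0"
    using under_le_0[OF assms] by blast
  then have "uncovered S \<noteq> {}"
    using assms by (intro uncovered_nonempty) auto
  then obtain x where "x \<in> X" "?U x \<le> 0"
    using S(3) unfolding uncovered_def by blast
  moreover have "root (iterate i) = root_oracle ?U"
    using Suc by (simp add: Let_def)
  ultimately have "?U (root (iterate i)) \<le> 0"
    using root_oracle_le[OF under_continuous[of i 1], of x] by simp
  then show ?thesis by (simp add: LB_def Suc)
qed

section \<open>The upper bound\<close>

text \<open>\<open>Suc T - t\<close> counts the remaining stages; each costs \<open>c\<close> and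
  penalties are nonnegative. For \<open>t > T\<close> truncated subtraction yields 0, the terminal
  value.\<close>

lemma backward_over_ge:
  assumes "\<And>t x. ereal (real (Suc T - t) * c) \<le> Q t x"
  shows "ereal (real (Suc T - t) * c) \<le> backward_over Q p t x"
proof (induction "Suc T - t" arbitrary: t x)
  case 0
  then show ?case by (subst backward_over.simps) auto
next
  case (Suc n)
  then have t: "t \<le> T" by simp
  let ?R = "backward_over Q p (Suc t) (fst (p t))"
  let ?a = "L * N (fst (p (t - 1)) - snd (p t))" and ?b = "L * N (x - fst (p (t - 1)))"
  have R: "ereal (real (T - t) * c) \<le> ?R"
    using Suc.hyps(1)[of "Suc t"] Suc.hyps(2) by simp
  have nonneg: "0 \<le> ?a" "0 \<le> ?b"
    using L_pos by (simp_all add: is_norm_nonneg[OF N])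
  \<comment> \<open>The summand \<open>ereal 0\<close> pairs with \<open>?b\<close>, so that the
    next comparison is termwise.\<close>
  have "ereal (real (Suc T - t) * c) = ereal c + ereal (real (T - t) * c) + ereal 0"
    using t by (simp add: Suc_diff_le algebra_simps)
  also have "\<dots> \<le> ereal (c + ?a) + ?R + ereal ?b"
    using nonneg by (intro add_mono R) auto
  finally have "ereal (real (Suc T - t) * c) \<le> min (Q t x) (ereal (c + ?a) + ?R + ereal ?b)"
    by (intro min.boundedI assms)
  also have "\<dots> = backward_over Q p t x"
    \<comment> \<open>\<open>?R\<close> holds the first occurrence of \<open>backward_over\<close>;
      only the one on the right is unfolded.\<close>
    using t by (subst (2) backward_over.simps) (simp add: Let_def)
  finally show ?case .
qed

lemma over_ge: "ereal (real (Suc T - t) * c) \<le> over (iterate i) t x"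
proof (induction i arbitrary: t x)
  case (Suc i)
  then show ?case by (simp add: Let_def backward_over_ge)
qed simp

lemma UB_ge: "ereal (real T * c) \<le> UB i"
proof (induction i)
  case (Suc i)
  then show ?case using over_ge[of 1] by (simp del: iterate.simps)
qed simp

end

theorem theorem4:
  fixes N :: "real ^ 'd \<Rightarrow> real"
    and T :: nat
    and D L \<epsilon> :: real
  assumes "is_norm N" and "T \<ge> 1" and "D > 0" and "L > 0" and "\<epsilon> > 0"
  shows "\<exists>f root_oracle fwd_oracle bwd_oracle.
    (\<forall>t\<in>{1..T}. lipschitz_wrt N L (state_space N D) (f t) \<and>
       (\<forall>x\<in>state_space N D. \<epsilon> / real T < f t x \<and> f t x < 2 * \<epsilon> / real T)) \<and>
    ddp.optimal_oracles N D L T f root_oracle fwd_oracle bwd_oracle \<and>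
    (\<forall>i\<ge>1. ddp.UB N D L T f root_oracle fwd_oracle bwd_oracle i
             - ereal (ddp.LB N D L T f root_oracle fwd_oracle bwd_oracle i) \<le> ereal \<epsilon> \<longrightarrow>
           real i \<ge> (D * L * real T / (4 * \<epsilon>)) ^ CARD('d))"
proof -
  let ?X = "state_space N D"
  \<comment> \<open>The midpoint of the allowed interval; the total \<open>T * c\<close> exceeds
    \<epsilon> by \<open>\<epsilon> / 2\<close>.\<close>
  define c where "c = 3 * \<epsilon> / (2 * real T)"
  define root_oracle where "root_oracle = (\<lambda>Q :: real ^ 'd \<Rightarrow> real. SOME x. is_arg_min Q (\<lambda>x. x \<in> ?X) x)"
  have c: "c > 0" "\<epsilon> / real T < c" "c < 2 * \<epsilon> / real T" "real T * c = 3 * \<epsilon> / 2"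
    using assms by (auto simp: c_def field_simps)
  have "0 \<in> ?X"
    using assms is_norm_eq_0_iff[OF assms(1), of 0] by (simp add: state_space_def)
  moreover have "compact ?X"
    unfolding state_space_def by (rule compact_norm_ball[OF assms(1)])
  ultimately have "\<exists>x. is_arg_min Q (\<lambda>x. x \<in> ?X) x" if "continuous_on ?X Q" for Q :: "real ^ 'd \<Rightarrow> real"
    using continuous_attains_inf[OF _ _ that] by (auto simp: is_arg_min_linorder)
  then have "is_arg_min Q (\<lambda>x. x \<in> ?X) (root_oracle Q)" if "continuous_on ?X Q" for Q
    unfolding root_oracle_def using that by (meson someI_ex)
  then interpret constant_cost_ddp N D L T c root_oracle
    using assms c by unfold_locales auto
  have "(D * L * real T / (4 * \<epsilon>)) ^ CARD('d) \<le> real i" if gap: "UB i - ereal (LB i) \<le> ereal \<epsilon>" for i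
  proof -
    \<comment> \<open>As \<open>UB i\<close> is at least \<open>3 * \<epsilon> / 2\<close>, a gap of
      at most \<epsilon> forces \<open>LB i\<close> to be positive, and the contrapositive of
      \<open>LB_le_0\<close> applies.\<close>
    have "ereal (3 * \<epsilon> / 2) - ereal (LB i) \<le> UB i - ereal (LB i)"
      using UB_ge[of i] c(4) by (intro ereal_minus_mono) auto
    then have "ereal (3 * \<epsilon> / 2) - ereal (LB i) \<le> ereal \<epsilon>"
      using gap by (rule order_trans)
    then have "LB i > 0"
      using \<open>\<epsilon> > 0\<close> by simp
    then have "(D * L / (2 * c)) ^ CARD('d) \<le> real i"
      using LB_le_0[of i] by linarith
    \<comment> \<open>The right-hand side equals
      \<open>D * L * T / (3 * \<epsilon>)\<close>.\<close>
    moreover have "D * L * real T / (4 * \<epsilon>) \<le> D * L / (2 * c)"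
      using assms by (simp add: c_def field_simps)
    then have "(D * L * real T / (4 * \<epsilon>)) ^ CARD('d) \<le> (D * L / (2 * c)) ^ CARD('d)"
      using assms by (intro power_mono) auto
    ultimately show ?thesis by linarith
  qed
  moreover have "lipschitz_wrt N L ?X (\<lambda>x. c)"
    using assms by (simp add: lipschitz_wrt_def is_norm_nonneg)
  ultimately show ?thesis
    using c optimal_oracles
    by (intro exI[of _ "\<lambda>t x. c"] exI[of _ root_oracle] exI[of _ "\<lambda>t y Q. (root_oracle Q, y)"]
        exI[of _ "\<lambda>t y Q. L"]) auto
qed

end
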